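(* The unit sphere is $$\mathsf S_{\mathfrak O}=\operatorname{graph}(F)\cup\operatorname{graph}(G)\cup\mathcal V,$$ where $\operatorname{graph}(F)=\{(a,F(a,c),c):(a,c)\in[-1,1]^2\}$, $\operatorname{graph}(G)=\{(a,G(a,c),c):(a,c)\in[-1,1]^2\}$ and $$\mathcal V=\{(a,b,c)\in\mathbb R^3:(a,c)\in\partial[-1,1]^2,\ G(a,c)\le b\le F(a,c)\}.$$
   Context: Let $\tau=\sqrt2-1$ and $\mathfrak O=\{(x,y)\in[0,1]^2: x+y\le\sqrt2\}$. A triple $(a,b,c)\in\mathbb R^3$ is identified with the quadratic form $P(x,y)=ax^2+bxy+cy^2$, and $\|(a,b,c)\|_{\mathfrak O}=\sup\{|P(x,y)|:(x,y)\in\mathfrak O\}$. Let $\mathsf S_{\mathfrak O}=\{(a,b,c)\in\mathbb R^3:\|(a,b,c)\|_{\mathfrak O}=1\}$. $\partial[-1,1]^2$ denotes the topological boundary of the square in $\mathbb R^2$. Define the regions $$\mathcal A=\{(a,c)\in[-1,1]^2:a\le0,\ 1+\tau^2a\le c\le1\},$$ $$\mathcal B=\{(a,c)\in[-1,1]^2:a\le c,\ \tau+\tau^2a\le c\le1+\tau^2a\},$$ $$\mathcal C=\{(a,c)\in[-1,1]^2:c\le\tau+\tau^2a,\ a\le\tau+\tau^2c\},$$ $$\mathcal D=\{(a,c)\in[-1,1]^2:c\le a,\ \tau+\tau^2c\le a\le1+\tau^2c\},$$ $$\mathcal E=\{(a,c)\in[-1,1]^2:c\le0,\ 1+\tau^2c\le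 a\le1\},$$ which cover $[-1,1]^2$, have pairwise disjoint interiors, and overlap only in boundary pieces. Define $F:[-1,1]^2\to\mathbb R$ by $$F(a,c)=\begin{cases}2\sqrt{-a(1-c)},&(a,c)\in\mathcal A,\\ \dfrac{1-c}{\tau}-\tau a,&(a,c)\in\mathcal B,\\ 1+\sqrt{(1-2a)(1-2c)},&(a,c)\in\mathcal C,\\ \dfrac{1-a}{\tau}-\tau c,&(a,c)\in\mathcal D,\\ 2\sqrt{-c(1-a)},&(a,c)\in\mathcal E;\end{cases}$$ the formulas agree on all overlaps, so $F$ is well defined. Define $G:[-1,1]^2\to\mathbb R$ by $G(a,c)=-F(-a,-c)$. *)

theory Defs
  imports "HOL-Analysis.Analysis"
begin

definition tau :: real ("\<tau>") where
  "\<tau> = sqrt 2 - 1"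

definition Oct :: "(real \<times> real) set" where
  "Oct = {(x, y). x \<in> {0..1} \<and> y \<in> {0..1} \<and> x + y \<le> sqrt 2}"

fun qform :: "real \<times> real \<times> real \<Rightarrow> real \<times> real \<Rightarrow> real" where
  "qform (a, b, c) (x, y) = a * x\<^sup>2 + b * x * y + c * y\<^sup>2"

definition norm_Oct :: "real \<times> real \<times> real \<Rightarrow> real" where
  "norm_Oct P = (SUP p\<in>Oct. \<bar>qform P p\<bar>)"

definition sphere_Oct :: "(real \<times> real \<times> real) set" where
  "sphere_Oct = {P. norm_Oct P = 1}"

definition Sq :: "(real \<times> real) set" where
  "Sq = {-1..1} \<times> {-1..1}"

definition reg_A :: "(real \<times> real) set" where
  "reg_A = {(a, c) \<in> Sq. a \<le> 0 \<and> 1 + \<tau>\<^sup>2 * a \<le> c \<and> c \<le> 1}"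

definition reg_B :: "(real \<times> real) set" where
  "reg_B = {(a, c) \<in> Sq. a \<le> c \<and> \<tau> + \<tau>\<^sup>2 * a \<le> c \<and> c \<le> 1 + \<tau>\<^sup>2 * a}"

definition reg_C :: "(real \<times> real) set" where
  "reg_C = {(a, c) \<in> Sq. c \<le> \<tau> + \<tau>\<^sup>2 * a \<and> a \<le> \<tau> + \<tau>\<^sup>2 * c}"

definition reg_D :: "(real \<times> real) set" where
  "reg_D = {(a, c) \<in> Sq. c \<le> a \<and> \<tau> + \<tau>\<^sup>2 * c \<le> a \<and> a \<le> 1 + \<tau>\<^sup>2 * c}"

definition reg_E :: "(real \<times> real) set" where
  "reg_E = {(a, c) \<in> Sq. c \<le> 0 \<and> 1 + \<tau>\<^sup>2 * c \<le> a \<and> a \<le> 1}"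

(* Only the values on Sq matter. The order of the tests is immaterial: the formulas
   agree on all overlaps, see F_regions below. *)
definition F :: "real \<times> real \<Rightarrow> real" where
  "F = (\<lambda>(a, c).
     if (a, c) \<in> reg_A then 2 * sqrt (- a * (1 - c))
     else if (a, c) \<in> reg_B then (1 - c) / \<tau> - \<tau> * a
     else if (a, c) \<in> reg_C then 1 + sqrt ((1 - 2 * a) * (1 - 2 * c))
     else if (a, c) \<in> reg_D then (1 - a) / \<tau> - \<tau> * c
     else if (a, c) \<in> reg_E then 2 * sqrt (- c * (1 - a))
     else undefined)"

definition G :: "real \<times> real \<Rightarrow> real" where
  "G = (\<lambda>(a, c). - F (- a, - c))"

definition graph :: "(real \<times> real \<Rightarrow> real) \<Rightarrow> (real \<times> real \<times> real) set" where
  "graph f = {(a, f (a, c), c) | a c. (a, c) \<in> Sq}"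

definition \<V> :: "(real \<times> real \<times> real) set" where
  "\<V> = {(a, b, c). (a, c) \<in> frontier Sq \<and> G (a, c) \<le> b \<and> b \<le> F (a, c)}"

lemma tau_pos: "0 < \<tau>" and tau_less_half: "\<tau> < 1/2" and tau_sq: "\<tau>\<^sup>2 = 1 - 2 * \<tau>"
proof -
  show "0 < \<tau>" by (simp add: tau_def)
  have "sqrt 2 < 3/2" by (rule real_less_lsqrt) (auto simp: power2_eq_square)
  then show "\<tau> < 1/2" by (simp add: tau_def)
  show "\<tau>\<^sup>2 = 1 - 2 * \<tau>" by (simp add: tau_def power2_eq_square algebra_simps)
qed

lemma inv_tau: "1 / \<tau> = \<tau> + 2"
  using tau_pos tau_sq by (simp add: field_simps power2_eq_square)

lemma overlap_CB:
  assumes "a \<le> c" "\<tau> + \<tau>\<^sup>2 * a = c"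
  shows "1 + sqrt ((1 - 2 * a) * (1 - 2 * c)) = (1 - c) / \<tau> - \<tau> * a"
proof -
  have "2 * \<tau> * a \<le> \<tau>" using assms tau_sq by (auto simp: algebra_simps)
  then have a: "2 * a \<le> 1" using tau_pos by (simp add: mult_le_cancel_left2)
  have "1 - 2 * c = \<tau>\<^sup>2 * (1 - 2 * a)" unfolding right_diff_distrib using assms(2) tau_sq by simp
  then have "(1 - 2 * a) * (1 - 2 * c) = (\<tau> * (1 - 2 * a))\<^sup>2"
    by (simp add: power2_eq_square)
  then have 1: "sqrt ((1 - 2 * a) * (1 - 2 * c)) = \<tau> * (1 - 2 * a)"
    using a tau_pos by simp
  have "1 - c = 1 - \<tau> - \<tau>\<^sup>2 * a" using assms by simp
  also have "\<dots> = \<tau> * (1 + \<tau> - \<tau> * a)" using tau_sq by (auto simp: algebra_simps power2_eq_square)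
  finally have "(1 - c) / \<tau> = 1 + \<tau> - \<tau> * a" using tau_pos by simp
  with 1 show ?thesis by (simp add: algebra_simps)
qed

lemma overlap_AB:
  assumes "a \<le> 0" "c = 1 + \<tau>\<^sup>2 * a"
  shows "2 * sqrt (- a * (1 - c)) = (1 - c) / \<tau> - \<tau> * a"
proof -
  have "- a * (1 - c) = (\<tau> * a)\<^sup>2" using assms(2) by (simp add: power2_eq_square)
  then have "sqrt (- a * (1 - c)) = - (\<tau> * a)"
    using assms(1) tau_pos by (simp add: abs_mult)
  moreover have "(1 - c) / \<tau> = - (\<tau> * a)"
    using assms(2) tau_pos by (simp add: power2_eq_square)
  ultimately show ?thesis by simp
qed

lemma tau_sq_less: "\<tau>\<^sup>2 < 1/4" "0 < \<tau>\<^sup>2" "\<tau> + \<tau>\<^sup>2 < 1 - \<tau>\<^sup>2"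
proof -
  have "2 < (17/12 :: real)\<^sup>2" "(7/5 :: real)\<^sup>2 < 2" by (auto simp: power2_eq_square)
  then have "sqrt 2 < 17/12" "7/5 < sqrt 2"
    using real_less_lsqrt[of "17/12" 2] real_less_rsqrt[of "7/5" 2] by simp_all
  then have "7/5 - 1 < \<tau>" "\<tau> < 17/12 - 1" by (simp_all add: tau_def)
  then show "\<tau>\<^sup>2 < 1/4" "0 < \<tau>\<^sup>2" "\<tau> + \<tau>\<^sup>2 < 1 - \<tau>\<^sup>2"
    using tau_sq by auto
qed

lemma Sq_bounds:
  assumes "(a, c) \<in> Sq"
  shows "- (\<tau>\<^sup>2) \<le> \<tau>\<^sup>2 * a" "\<tau>\<^sup>2 * a \<le> \<tau>\<^sup>2" "- (\<tau>\<^sup>2) \<le> \<tau>\<^sup>2 * c" "\<tau>\<^sup>2 * c \<le> \<tau>\<^sup>2"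
proof -
  have "\<tau>\<^sup>2 * (-1) \<le> \<tau>\<^sup>2 * x \<and> \<tau>\<^sup>2 * x \<le> \<tau>\<^sup>2 * 1" if "x \<in> {-1..1}" for x :: real
    using that by (intro conjI mult_left_mono) auto
  from this[of a] this[of c] assms
  show "- (\<tau>\<^sup>2) \<le> \<tau>\<^sup>2 * a" "\<tau>\<^sup>2 * a \<le> \<tau>\<^sup>2" "- (\<tau>\<^sup>2) \<le> \<tau>\<^sup>2 * c" "\<tau>\<^sup>2 * c \<le> \<tau>\<^sup>2"
    by (auto simp: Sq_def)
qed

lemma Sq_cover: "Sq = reg_A \<union> reg_B \<union> reg_C \<union> reg_D \<union> reg_E"
proof -
  have half: "(x \<le> 0 \<and> 1 + \<tau>\<^sup>2 * x \<le> y) \<or> (\<tau> + \<tau>\<^sup>2 * x \<le> y \<and> y \<le> 1 + \<tau>\<^sup>2 * x)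
      \<or> (y \<le> \<tau> + \<tau>\<^sup>2 * x \<and> x \<le> \<tau> + \<tau>\<^sup>2 * y)" if "x \<le> y" "y \<le> 1" for x y :: real
  proof -
    have 1: "\<tau>\<^sup>2 * x \<le> \<tau>\<^sup>2 * y" using that by (intro mult_left_mono) auto
    have "0 \<le> \<tau>\<^sup>2 * x" if "0 \<le> x" using that by simp
    with 1 that show ?thesis by linarith
  qed
  have "(a, c) \<in> reg_A \<union> reg_B \<union> reg_C \<union> reg_D \<union> reg_E" if "(a, c) \<in> Sq" for a c
    using that half[of a c] half[of c a]
    unfolding reg_A_def reg_B_def reg_C_def reg_D_def reg_E_def Sq_def
    by (cases "a \<le> c") auto
  then show ?thesis
    by (auto simp: reg_A_def reg_B_def reg_C_def reg_D_def reg_E_def)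
qed

lemma F_regions:
  shows F_A: "(a, c) \<in> reg_A \<Longrightarrow> F (a, c) = 2 * sqrt (- a * (1 - c))"
    and F_B: "(a, c) \<in> reg_B \<Longrightarrow> F (a, c) = (1 - c) / \<tau> - \<tau> * a"
    and F_C: "(a, c) \<in> reg_C \<Longrightarrow> F (a, c) = 1 + sqrt ((1 - 2 * a) * (1 - 2 * c))"
    and F_D: "(a, c) \<in> reg_D \<Longrightarrow> F (a, c) = (1 - a) / \<tau> - \<tau> * c"
    and F_E: "(a, c) \<in> reg_E \<Longrightarrow> F (a, c) = 2 * sqrt (- c * (1 - a))"
proof -
  note regs = reg_A_def reg_B_def reg_C_def reg_D_def reg_E_def
  note ineqs = Sq_bounds[of a c] tau_pos tau_less_half tau_sq_less
  have AB: "a \<le> 0 \<and> c = 1 + \<tau>\<^sup>2 * a" if "(a, c) \<in> reg_A" "(a, c) \<in> reg_B"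
    using that by (auto simp: regs)
  have AC: False if "(a, c) \<in> reg_A" "(a, c) \<in> reg_C"
    using that ineqs unfolding regs by auto
  have AD: False if "(a, c) \<in> reg_A" "(a, c) \<in> reg_D"
    using that ineqs unfolding regs by auto
  have AE: False if "(a, c) \<in> reg_A" "(a, c) \<in> reg_E"
    using that ineqs unfolding regs by auto
  have BC: "a \<le> c \<and> \<tau> + \<tau>\<^sup>2 * a = c" if "(a, c) \<in> reg_B" "(a, c) \<in> reg_C"
    using that by (auto simp: regs)
  have BD: "a = c" if "(a, c) \<in> reg_B" "(a, c) \<in> reg_D"
    using that by (auto simp: regs)
  have BE: False if "(a, c) \<in> reg_B" "(a, c) \<in> reg_E"
    using that ineqs unfolding regs by auto
  have CD: "c \<le> a \<and> \<tau> + \<tau>\<^sup>2 * c = a" if "(a, c) \<in> reg_C" "(a, c) \<in> reg_D"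
    using that by (auto simp: regs)
  have CE: False if "(a, c) \<in> reg_C" "(a, c) \<in> reg_E"
    using that ineqs unfolding regs by auto
  have DE: "c \<le> 0 \<and> a = 1 + \<tau>\<^sup>2 * c" if "(a, c) \<in> reg_D" "(a, c) \<in> reg_E"
    using that by (auto simp: regs)
  have CDv: "1 + sqrt ((1 - 2 * a) * (1 - 2 * c)) = (1 - a) / \<tau> - \<tau> * c"
    if "(a, c) \<in> reg_C" "(a, c) \<in> reg_D"
    using overlap_CB[of c a] CD[OF that] by (simp add: mult.commute)
  have DEv: "2 * sqrt (- c * (1 - a)) = (1 - a) / \<tau> - \<tau> * c"
    if "(a, c) \<in> reg_D" "(a, c) \<in> reg_E"
    using overlap_AB[of c a] DE[OF that] by blast
  show A: "F (a, c) = 2 * sqrt (- a * (1 - c))" if "(a, c) \<in> reg_A"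
    using that by (simp add: F_def)
  show B: "F (a, c) = (1 - c) / \<tau> - \<tau> * a" if "(a, c) \<in> reg_B"
    using that A AB overlap_AB[of a c] by (cases "(a, c) \<in> reg_A") (auto simp: F_def)
  show C: "F (a, c) = 1 + sqrt ((1 - 2 * a) * (1 - 2 * c))" if "(a, c) \<in> reg_C"
    using that AC B BC overlap_CB[of a c]
    by (cases "(a, c) \<in> reg_B") (auto simp: F_def)
  show D: "F (a, c) = (1 - a) / \<tau> - \<tau> * c" if "(a, c) \<in> reg_D"
  proof -
    consider "(a, c) \<in> reg_B" | "(a, c) \<in> reg_C" | "(a, c) \<notin> reg_B" "(a, c) \<notin> reg_C" by blast
    then show ?thesis
    proof cases
      case 1 then show ?thesis using B[OF 1] BD[OF 1 that] by simp
    next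
      case 2 then show ?thesis using C[OF 2] CDv[OF 2 that] by simp
    next
      case 3 then show ?thesis using that AD by (auto simp: F_def)
    qed
  qed
  show "F (a, c) = 2 * sqrt (- c * (1 - a))" if "(a, c) \<in> reg_E"
  proof (cases "(a, c) \<in> reg_D")
    case True then show ?thesis using D[OF True] DEv[OF True that] by simp
  next
    case False
    moreover have "(a, c) \<notin> reg_A" "(a, c) \<notin> reg_B" "(a, c) \<notin> reg_C"
      using that AE BE CE by blast+
    ultimately show ?thesis using that by (simp add: F_def)
  qed
qed

end

theory Submission
  imports Defs
begin

text \<open>
  For \<open>(a, c)\<close> in the square, \<open>P \<le> 1\<close> holds on the octagon iff \<open>b \<le> F (a, c)\<close>.
  Since \<open>x y \<ge> 0\<close>, sufficiency only has to be checked at \<open>b = F (a, c)\<close>, where on region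
  \<open>\<A>\<close> the difference \<open>P - y\<^sup>2\<close> and on region \<open>\<C>\<close> the difference \<open>P - (x + y)\<^sup>2 / 2\<close> is
  minus a square, while on region \<open>\<B>\<close> both differences have the factor \<open>x - \<tau> y\<close>. Necessity follows
  by evaluating at the point where \<open>P = 1\<close>: the zero of the square, respectively the vertex
  \<open>(\<tau>, 1)\<close>. Regions \<open>\<D>\<close> and \<open>\<E>\<close> are mirror images, and \<open>P \<ge> -1\<close> is the same condition on
  \<open>-P\<close>, which gives \<open>G\<close>. Finally, perturbing \<open>b\<close> separates the sphere from the interior of the ball:
  an extremal point of the form with \<open>x y > 0\<close> leaves no room to move \<open>b\<close>, and one with
  \<open>x y = 0\<close> forces \<open>\<bar>a\<bar> = 1\<close> or \<open>\<bar>c\<bar> = 1\<close>.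
\<close>

section \<open>The one-sided bound \<open>P \<le> 1\<close> on the octagon, its symmetry and
  monotonicity\<close>

definition le_one_Oct :: "real \<Rightarrow> real \<Rightarrow> real \<Rightarrow> bool" where
  "le_one_Oct a b c \<longleftrightarrow> (\<forall>p\<in>Oct. qform (a, b, c) p \<le> 1)"

lemma OctD:
  assumes "(x, y) \<in> Oct"
  shows "0 \<le> x" "x \<le> 1" "0 \<le> y" "y \<le> 1" "x + y \<le> sqrt 2"
  using assms by (auto simp: Oct_def)

lemma OctI: "0 \<le> x \<Longrightarrow> x \<le> 1 \<Longrightarrow> 0 \<le> y \<Longrightarrow> y \<le> 1 \<Longrightarrow> x + y \<le> sqrt 2 \<Longrightarrow> (x, y) \<in> Oct"
  by (simp add: Oct_def)

lemma Oct_sum_sq: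
  assumes "(x, y) \<in> Oct"
  shows "(x + y)\<^sup>2 / 2 \<le> 1"
proof -
  have "(x + y)\<^sup>2 \<le> (sqrt 2)\<^sup>2" using OctD[OF assms] by (intro power_mono) auto
  then show ?thesis by simp
qed

lemma le_one_OctI:
  assumes "\<And>x y. (x, y) \<in> Oct \<Longrightarrow> a * x\<^sup>2 + b * x * y + c * y\<^sup>2 \<le> 1"
  shows "le_one_Oct a b c"
  using assms by (auto simp: le_one_Oct_def)

lemma le_one_OctD:
  assumes "le_one_Oct a b c" "(x, y) \<in> Oct"
  shows "a * x\<^sup>2 + b * x * y + c * y\<^sup>2 \<le> 1"
  using assms by (force simp: le_one_Oct_def)

lemma le_one_Oct_swap: "le_one_Oct a b c \<Longrightarrow> le_one_Oct c b a"
proof (rule le_one_OctI)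
  fix x y assume "le_one_Oct a b c" "(x, y) \<in> Oct"
  then show "c * x\<^sup>2 + b * x * y + a * y\<^sup>2 \<le> 1"
    using le_one_OctD[of a b c y x] OctD[of x y] OctI[of y x] by (simp add: algebra_simps)
qed

lemma le_one_Oct_mono:
  assumes "le_one_Oct a b c" "b' \<le> b"
  shows "le_one_Oct a b' c"
proof (rule le_one_OctI)
  fix x y assume p: "(x, y) \<in> Oct"
  have "b' * (x * y) \<le> b * (x * y)"
    using OctD[OF p] assms(2) by (intro mult_right_mono) auto
  then show "a * x\<^sup>2 + b' * x * y + c * y\<^sup>2 \<le> 1"
    using le_one_OctD[OF assms(1) p] by (simp add: mult.assoc)
qed

section \<open>Sufficiency: the formula for \<open>b\<close> on each region keeps
  \<open>P \<le> 1\<close>\<close>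

lemma le_one_A:
  assumes "a \<le> 0" "c \<le> 1"
  shows "le_one_Oct a (2 * sqrt (- a * (1 - c))) c"
proof (rule le_one_OctI)
  fix x y assume p: "(x, y) \<in> Oct"
  define u v where "u = sqrt (- a)" and "v = sqrt (1 - c)"
  have a: "a = - u\<^sup>2" and c: "c = 1 - v\<^sup>2" and s: "sqrt (- a * (1 - c)) = u * v"
    using assms by (simp_all add: u_def v_def real_sqrt_mult[symmetric])
  have "a * x\<^sup>2 + (2 * (u * v)) * x * y + c * y\<^sup>2 = y\<^sup>2 - (u * x - v * y)\<^sup>2"
    unfolding a c by (simp add: power2_eq_square algebra_simps)
  also have "\<dots> \<le> y\<^sup>2" by simp
  also have "\<dots> \<le> 1" using OctD[OF p] by (simp add: power_le_one)
  finally show "a * x\<^sup>2 + 2 * sqrt (- a * (1 - c)) * x * y + c * y\<^sup>2 \<le> 1" unfolding s .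
qed

text \<open>The rays through the vertices \<open>(\<tau>, 1)\<close> and \<open>(1, \<tau>)\<close>
  cut the octagon into three sectors. In them \<open>P\<close> is compared with
  \<open>y\<^sup>2\<close>, \<open>(x + y)\<^sup>2 / 2\<close> and \<open>x\<^sup>2\<close>
  respectively, each of which is at most 1 on the octagon.\<close>

lemma le_one_B:
  assumes "a \<le> 1" "c \<le> 1" "-1 \<le> a" "a \<le> c" "\<tau> + \<tau>\<^sup>2 * a \<le> c" "c \<le> 1 + \<tau>\<^sup>2 * a"
  shows "le_one_Oct a ((1 - c) / \<tau> - \<tau> * a) c"
proof (rule le_one_OctI)
  fix x y assume p: "(x, y) \<in> Oct"
  define b where "b = (1 - c) / \<tau> - \<tau> * a"
  note xy = OctD[OF p] and t = tau_pos tau_less_half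
  let ?P = "a * x\<^sup>2 + b * x * y + c * y\<^sup>2"
  have c1: "(1 - c) / \<tau> \<ge> - (\<tau> * a)"
    using assms(6) t by (simp add: field_simps power2_eq_square)
  \<comment> \<open>Stated for every point of the middle sector because it is used again at the
    vertex \<open>(1, \<tau>)\<close> in the third sector.\<close>
  have diag: "a * x\<^sup>2 + b * x * y + c * y\<^sup>2 \<le> (x + y)\<^sup>2 / 2"
    if "\<tau> * y \<le> x" "\<tau> * x \<le> y" "0 \<le> x" "0 \<le> y" for x y
  proof -
    \<comment> \<open>The identity \<open>1 / \<tau> = \<tau> + 2\<close> recentres \<open>b\<close>
      so that \<open>P - (x + y)\<^sup>2 / 2\<close> visibly vanishes on the ray
      \<open>x = \<tau> * y\<close>.\<close>
    have b': "b = (1/2 - c) / \<tau> - \<tau> * (a - 1/2) + 1"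
    proof -
      have "(1 - c) / \<tau> = (1/2 - c) / \<tau> + (1 / \<tau>) / 2"
        by (simp add: diff_divide_distrib)
      then show ?thesis unfolding b_def inv_tau by (simp add: algebra_simps)
    qed
    have "a * x\<^sup>2 + b * x * y + c * y\<^sup>2 - (x + y)\<^sup>2 / 2
        = (x - \<tau> * y) * ((a - 1/2) * x + (1/2 - c) / \<tau> * y)"
    proof -
      define k where "k = (1/2 - c) / \<tau>"
      have c: "c = 1/2 - \<tau> * k" using t by (simp add: k_def)
      show ?thesis unfolding b' k_def[symmetric] unfolding c by algebra
    qed
    also have "\<dots> \<le> 0"
    proof (rule mult_nonneg_nonpos)
      show "0 \<le> x - \<tau> * y" using that by simp
      show "(a - 1/2) * x + (1/2 - c) / \<tau> * y \<le> 0"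
      \<comment> \<open>The sign of \<open>a - 1/2\<close> decides which bounding ray is the worst
        case. On \<open>x = \<tau> * y\<close> the lower bound on \<open>c\<close> settles it, on
        \<open>y = \<tau> * x\<close> the inequality \<open>a \<le> c\<close>.\<close>
      proof (cases "a \<le> 1/2")
        case True
        have "1/2 - c \<le> (\<tau> * (1/2 - a)) * \<tau>"
        proof -
          have "(\<tau> * (1/2 - a)) * \<tau> = \<tau>\<^sup>2 / 2 - \<tau>\<^sup>2 * a"
            by (simp add: power2_eq_square algebra_simps)
          then show ?thesis using assms(5) tau_sq by linarith
        qed
        then have "(1/2 - c) / \<tau> \<le> \<tau> * (1/2 - a)" using t by (simp add: pos_divide_le_eq)
        then have "(1/2 - c) / \<tau> * y \<le> \<tau> * (1/2 - a) * y" using that by (intro mult_right_mono)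
        moreover have "(1/2 - a) * (\<tau> * y) \<le> (1/2 - a) * x"
          using True that by (intro mult_left_mono) auto
        ultimately show ?thesis by (simp add: algebra_simps)
      next
        case False
        have "(1/2 - c) / \<tau> * y \<le> (1/2 - a) / \<tau> * y"
          using t that assms by (intro mult_right_mono divide_right_mono) auto
        moreover have "x \<le> y / \<tau>" using that t by (simp add: field_simps)
        then have "(a - 1/2) * x \<le> (a - 1/2) * (y / \<tau>)" using False by (intro mult_left_mono) auto
        ultimately show ?thesis by (simp add: algebra_simps diff_divide_distrib)
      qed
    qed
    finally show ?thesis by simp
  qed
  consider "x \<le> \<tau> * y" | "\<tau> * y \<le> x" "\<tau> * x \<le> y" | "y \<le> \<tau> * x" by linarith
  then have "?P \<le> 1"
  proof cases
    case 1
    have "?P - y\<^sup>2 = (x - \<tau> * y) * (a * x + (1 - c) / \<tau> * y)"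
    proof -
      define k where "k = (1 - c) / \<tau>"
      have c: "c = 1 - \<tau> * k" using t by (simp add: k_def)
      show ?thesis unfolding b_def k_def[symmetric] unfolding c by algebra
    qed
    also have "\<dots> \<le> 0"
    proof (rule mult_nonpos_nonneg)
      show "x - \<tau> * y \<le> 0" using 1 by simp
      show "0 \<le> a * x + (1 - c) / \<tau> * y"
      \<comment> \<open>For negative \<open>a\<close> the factor is smallest at
        \<open>x = \<tau> * y\<close>, where it is nonnegative by \<open>c1\<close>, that is, by the
        upper bound on \<open>c\<close>.\<close>
      proof (cases "0 \<le> a")
        case True then show ?thesis using xy t assms by simp
      next
        case False
        have "- (\<tau> * a) * y \<le> (1 - c) / \<tau> * y" using c1 xy by (intro mult_right_mono)
        moreover have "a * (\<tau> * y) \<le> a * x" using False 1 by (intro mult_left_mono_neg) auto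
        ultimately show ?thesis by (simp add: algebra_simps)
      qed
    qed
    finally have "?P \<le> y\<^sup>2" by simp
    also have "\<dots> \<le> 1" using xy by (simp add: power_le_one)
    finally show ?thesis .
  next
    case 2
    then show ?thesis using diag[OF 2] xy Oct_sum_sq[OF p] by linarith
  next
    case 3
    have "\<tau>\<^sup>2 * (-1) \<le> \<tau>\<^sup>2 * a" using assms by (intro mult_left_mono) auto
    then have c0: "0 \<le> c" using assms(5) tau_sq_less tau_sq by linarith
    \<comment> \<open>The comparison form \<open>(x + y)\<^sup>2 / 2\<close> equals 1 at the vertex
      \<open>(1, \<tau>)\<close>, so \<open>diag\<close> bounds \<open>P\<close> there by 1.\<close>
    have sq: "(1 + \<tau>)\<^sup>2 / 2 = 1" by (simp add: tau_def)
    have "\<tau> * \<tau> \<le> 1 * 1" using t by (intro mult_mono) auto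
    then have "a * 1\<^sup>2 + b * 1 * \<tau> + c * \<tau>\<^sup>2 \<le> (1 + \<tau>)\<^sup>2 / 2"
      using t by (intro diag) auto
    then have v: "a + b * \<tau> + c * \<tau>\<^sup>2 \<le> 1" unfolding sq by simp
    \<comment> \<open>Since \<open>c\<close> is nonnegative, one factor \<open>y\<close> may be
      replaced by \<open>\<tau> * x\<close>. The result is linear in \<open>y\<close>, so its
      maximum is at \<open>y = 0\<close>, where \<open>a \<le> 1\<close> suffices, or at
      \<open>y = \<tau> * x\<close>, where \<open>v\<close> does.\<close>
    have "c * y * y \<le> c * y * (\<tau> * x)" using c0 3 xy by (intro mult_left_mono) auto
    then have "?P \<le> a * x\<^sup>2 + (b + c * \<tau>) * (x * y)"
      by (simp add: power2_eq_square algebra_simps)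
    also have "\<dots> \<le> x\<^sup>2"
    proof (cases "b + c * \<tau> \<le> 0")
      case True
      then have "(b + c * \<tau>) * (x * y) \<le> 0" using xy by (intro mult_nonpos_nonneg) auto
      moreover have "a * x\<^sup>2 \<le> 1 * x\<^sup>2" using assms by (intro mult_right_mono) auto
      ultimately show ?thesis by simp
    next
      case False
      have "(b + c * \<tau>) * (x * y) \<le> (b + c * \<tau>) * (x * (\<tau> * x))"
        using False 3 xy by (intro mult_left_mono) auto
      moreover have "(a + b * \<tau> + c * \<tau>\<^sup>2) * x\<^sup>2 \<le> 1 * x\<^sup>2" using v by (intro mult_right_mono) auto
      ultimately show ?thesis by (simp add: power2_eq_square algebra_simps)
    qed
    also have "\<dots> \<le> 1" using xy by (simp add: power_le_one)
    finally show ?thesis .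
  qed
  then show "a * x\<^sup>2 + ((1 - c) / \<tau> - \<tau> * a) * x * y + c * y\<^sup>2 \<le> 1" by (simp add: b_def)
qed

lemma le_one_C:
  assumes "a \<le> 1/2" "c \<le> 1/2"
  shows "le_one_Oct a (1 + sqrt ((1 - 2 * a) * (1 - 2 * c))) c"
proof (rule le_one_OctI)
  fix x y assume p: "(x, y) \<in> Oct"
  define u v where "u = sqrt (1 - 2 * a)" and "v = sqrt (1 - 2 * c)"
  have a: "a = (1 - u\<^sup>2) / 2" and c: "c = (1 - v\<^sup>2) / 2"
    and s: "sqrt ((1 - 2 * a) * (1 - 2 * c)) = u * v"
    using assms by (simp_all add: u_def v_def real_sqrt_mult)
  have "a * x\<^sup>2 + (1 + u * v) * x * y + c * y\<^sup>2 = (x + y)\<^sup>2 / 2 - (u * x - v * y)\<^sup>2 / 2"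
    unfolding a c by (simp add: power2_eq_square field_simps)
  also have "\<dots> \<le> (x + y)\<^sup>2 / 2" by simp
  also have "\<dots> \<le> 1" by (rule Oct_sum_sq[OF p])
  finally show "a * x\<^sup>2 + (1 + sqrt ((1 - 2 * a) * (1 - 2 * c))) * x * y + c * y\<^sup>2 \<le> 1"
    unfolding s .
qed

section \<open>Necessity: evaluation at a point where the extremal form equals 1\<close>

lemma Oct_edge:
  assumes "0 \<le> t" "t \<le> \<tau>"
  shows "(t, 1) \<in> Oct"
  using assms tau_less_half by (intro OctI) (auto simp: tau_def)

text \<open>The test point is \<open>(v / u, 1)\<close>, the zero of \<open>u * x - v * y\<close> on
  the edge \<open>y = 1\<close>. The bound \<open>1 + \<tau>\<^sup>2 * a \<le> c\<close> says
  exactly that \<open>v / u \<le> \<tau>\<close>, so the point belongs to the octagon.\<close>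

lemma le_one_A_D:
  assumes "le_one_Oct a b c" "-1 \<le> a" "a \<le> 0" "c \<le> 1" "1 + \<tau>\<^sup>2 * a \<le> c"
  shows "b \<le> 2 * sqrt (- a * (1 - c))"
\<comment> \<open>For \<open>c = 1\<close> the test point degenerates to \<open>(0, 1)\<close>,
  where \<open>P\<close> does not depend on \<open>b\<close>; nearby points of the edge are used
  instead.\<close>
proof (cases "c = 1")
  case True
  have "b \<le> 0"
  proof (rule ccontr)
    assume "\<not> b \<le> 0"
    \<comment> \<open>The bound \<open>t \<le> \<tau>\<close> keeps \<open>(t, 1)\<close> on the
      edge, and \<open>t < b\<close> together with \<open>-1 \<le> a\<close> makes
      \<open>a * t + b\<close> positive.\<close>
    define t where "t = min \<tau> (b / 2)"
    have t: "0 < t" "t \<le> \<tau>" "t < b" using \<open>\<not> b \<le> 0\<close> tau_pos by (auto simp: t_def)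
    have "a * t\<^sup>2 + b * t * 1 + c * 1\<^sup>2 \<le> 1"
      using t by (intro le_one_OctD[OF assms(1) Oct_edge]) auto
    then have "t * (a * t + b) \<le> 0"
      using True by (simp add: power2_eq_square algebra_simps)
    then have "a * t + b \<le> 0" using t(1) by (simp add: mult_le_0_iff)
    moreover have "-1 * t \<le> a * t" using assms t by (intro mult_right_mono) auto
    ultimately show False using t by simp
  qed
  then show ?thesis using True by simp
next
  case False
  define u v where "u = sqrt (- a)" and "v = sqrt (1 - c)"
  have a: "a = - u\<^sup>2" and c: "c = 1 - v\<^sup>2" and s: "sqrt (- a * (1 - c)) = u * v"
    using assms by (simp_all add: u_def v_def real_sqrt_mult[symmetric])
  have v0: "0 < v" using False assms by (simp add: v_def)
  have "a \<noteq> 0" using assms False by auto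
  then have u0: "0 < u" using assms by (simp add: u_def)
  have "v\<^sup>2 \<le> (\<tau> * u)\<^sup>2" using assms(5) unfolding a c by (simp add: power_mult_distrib)
  then have "v \<le> \<tau> * u" by (rule power2_le_imp_le) (use u0 tau_pos in auto)
  then have "v / u \<le> \<tau>" using u0 by (simp add: pos_divide_le_eq)
  then have "a * (v / u)\<^sup>2 + b * (v / u) * 1 + c * 1\<^sup>2 \<le> 1"
    using u0 v0 by (intro le_one_OctD[OF assms(1) Oct_edge]) auto
  moreover have "a * (v / u)\<^sup>2 = - v\<^sup>2" using u0 unfolding a by (simp add: power_divide)
  ultimately have "b * v \<le> (2 * (u * v)) * v"
    using u0 unfolding c by (simp add: field_simps power2_eq_square)
  then show ?thesis unfolding s using v0 by simp
qed

lemma le_one_B_D: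
  assumes "le_one_Oct a b c"
  shows "b \<le> (1 - c) / \<tau> - \<tau> * a"
proof -
  have "a * \<tau>\<^sup>2 + b * \<tau> * 1 + c * 1\<^sup>2 \<le> 1"
    using tau_pos by (intro le_one_OctD[OF assms Oct_edge]) auto
  then show ?thesis using tau_pos by (simp add: field_simps power2_eq_square)
qed

text \<open>The two boundary lines meet at \<open>(1/2, 1/2)\<close>. Inserting one inequality into
  the other bounds \<open>a - 1/2\<close> by itself times the fourth power of \<open>\<tau>\<close>,
  a factor below 1. This makes the square roots on region C meaningful.\<close>

lemma reg_C_le_half:
  assumes "c \<le> \<tau> + \<tau>\<^sup>2 * a" "a \<le> \<tau> + \<tau>\<^sup>2 * c"
  shows "a \<le> 1/2"
proof -
  have "\<tau>\<^sup>2 * c \<le> \<tau>\<^sup>2 * (\<tau> + \<tau>\<^sup>2 * a)" using assms by (intro mult_left_mono) auto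
  then have "a - 1/2 \<le> \<tau> + \<tau>\<^sup>2 * (\<tau> + \<tau>\<^sup>2 * a) - 1/2" using assms by linarith
  also have "\<dots> = \<tau>\<^sup>2 * \<tau>\<^sup>2 * (a - 1/2)"
  proof -
    have "\<tau> = (1 - \<tau>\<^sup>2) / 2" using tau_sq by simp
    then have "\<tau> + \<tau>\<^sup>2 * (\<tau> + \<tau>\<^sup>2 * a) - 1/2
      = (1 - \<tau>\<^sup>2) / 2 + \<tau>\<^sup>2 * ((1 - \<tau>\<^sup>2) / 2 + \<tau>\<^sup>2 * a) - 1/2" by metis
    then show ?thesis by (simp add: field_simps)
  qed
  finally have "(a - 1/2) * (1 - \<tau>\<^sup>2 * \<tau>\<^sup>2) \<le> 0" by (simp add: algebra_simps)
  moreover have "\<tau>\<^sup>2 * \<tau>\<^sup>2 < 1 * 1" using tau_sq_less by (intro mult_strict_mono) auto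
  ultimately show ?thesis by (simp add: mult_le_0_iff)
qed

text \<open>The test point is the zero of \<open>u * x - v * y\<close> on the edge
  \<open>x + y = sqrt 2\<close>. The two region inequalities place it between the vertices
  \<open>(\<tau>, 1)\<close> and \<open>(1, \<tau>)\<close>.\<close>

lemma le_one_C_D:
  assumes "le_one_Oct a b c" "c \<le> \<tau> + \<tau>\<^sup>2 * a" "a \<le> \<tau> + \<tau>\<^sup>2 * c"
  shows "b \<le> 1 + sqrt ((1 - 2 * a) * (1 - 2 * c))"
proof -
  define u v where "u = sqrt (1 - 2 * a)" and "v = sqrt (1 - 2 * c)"
  have half: "a \<le> 1/2" "c \<le> 1/2" using reg_C_le_half assms by blast+
  have a: "a = (1 - u\<^sup>2) / 2" and c: "c = (1 - v\<^sup>2) / 2"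
    and s: "sqrt ((1 - 2 * a) * (1 - 2 * c)) = u * v" and uv0: "0 \<le> u" "0 \<le> v"
    using half by (simp_all add: u_def v_def real_sqrt_mult)
  have "\<tau>\<^sup>2 * (1 - 2 * a) \<le> 1 - 2 * c" "\<tau>\<^sup>2 * (1 - 2 * c) \<le> 1 - 2 * a"
    unfolding right_diff_distrib using assms tau_sq by linarith+
  then have "(\<tau> * u)\<^sup>2 \<le> v\<^sup>2" "(\<tau> * v)\<^sup>2 \<le> u\<^sup>2"
    using half by (simp_all add: u_def v_def power_mult_distrib)
  then have uv: "\<tau> * u \<le> v" "\<tau> * v \<le> u" using uv0 by (auto intro: power2_le_imp_le)
  show ?thesis
  proof (cases "u = 0")
    \<comment> \<open>Here \<open>a = c = 1/2\<close> and the square vanishes identically, so the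
      midpoint of the slanted edge serves as test point.\<close>
    case True
    then have "v = 0" using uv uv0 tau_pos by (simp add: mult_le_0_iff)
    have "1 \<le> sqrt 2" by simp
    then have "(sqrt 2 / 2, sqrt 2 / 2) \<in> Oct" by (intro OctI) (auto intro: real_le_lsqrt)
    from le_one_OctD[OF assms(1) this] have "b \<le> 1"
      using True \<open>v = 0\<close> unfolding a c by (simp add: power_divide mult.assoc)
    then show ?thesis using True unfolding s by simp
  next
    case False
    then have u: "0 < u" using uv0 by simp
    then have v: "0 < v" using uv tau_pos by (smt (verit) mult_pos_pos)
    \<comment> \<open>The factor \<open>r\<close> scales the direction \<open>(v, u)\<close> onto
      the line \<open>x + y = sqrt 2\<close>.\<close>
    define r where "r = sqrt 2 / (u + v)"
    have r: "r > 0" "r * (u + v) = sqrt 2" "r\<^sup>2 * (u + v)\<^sup>2 = 2"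
      using u v by (simp_all add: r_def power_divide)
    \<comment> \<open>Because \<open>sqrt 2 = 1 + \<tau>\<close>, these restate \<open>uv\<close>;
      they keep both scaled coordinates at most 1.\<close>
    have le: "sqrt 2 * v \<le> u + v" "sqrt 2 * u \<le> u + v"
      using uv by (simp_all add: tau_def algebra_simps)
    have "r * v + r * u \<le> sqrt 2" using r(2) by (simp add: algebra_simps)
    moreover have "r * v \<le> 1" "r * u \<le> 1" using u v le by (simp_all add: r_def)
    ultimately have "(r * v, r * u) \<in> Oct" using r(1) u v by (intro OctI) auto
    from le_one_OctD[OF assms(1) this]
    have "r\<^sup>2 * (a * v\<^sup>2 + b * v * u + c * u\<^sup>2) \<le> r\<^sup>2 * ((u + v)\<^sup>2 / 2)"
      using r(3) by (simp add: power2_eq_square algebra_simps)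
    then have "a * v\<^sup>2 + b * v * u + c * u\<^sup>2 \<le> (u + v)\<^sup>2 / 2" using r(1) by simp
    then have "b * (u * v) \<le> (1 + u * v) * (u * v)"
      unfolding a c by (simp add: power2_eq_square field_simps)
    then show ?thesis unfolding s using u v by simp
  qed
qed

section \<open>The one-sided bound over the whole square\<close>

lemma le_one_Oct_iff:
  assumes "(a, c) \<in> Sq"
  shows "le_one_Oct a b c \<longleftrightarrow> b \<le> F (a, c)"
proof
  note regs = reg_A_def reg_B_def reg_C_def reg_D_def reg_E_def Sq_def
  consider "(a, c) \<in> reg_A" | "(a, c) \<in> reg_B" | "(a, c) \<in> reg_C" | "(a, c) \<in> reg_D"
    | "(a, c) \<in> reg_E"
    using assms Sq_cover by blast
  note region_cases = this
  show "b \<le> F (a, c)" if P: "le_one_Oct a b c"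
    using region_cases
  proof cases
    case 1 then show ?thesis using le_one_A_D[OF P] F_A[OF 1] by (simp add: regs)
  next
    case 2 then show ?thesis using le_one_B_D[OF P] F_B[OF 2] by simp
  next
    case 3 then show ?thesis using le_one_C_D[OF P] F_C[OF 3] by (simp add: regs)
  next
    case 4 then show ?thesis using le_one_B_D[OF le_one_Oct_swap[OF P]] F_D[OF 4] by simp
  next
    case 5 then show ?thesis
      using le_one_A_D[OF le_one_Oct_swap[OF P]] F_E[OF 5] by (simp add: regs)
  qed
  have "le_one_Oct a (F (a, c)) c"
    using region_cases
  proof cases
    case 1 then show ?thesis using le_one_A[of a c] F_A[OF 1] by (simp add: regs)
  next
    case 2 then show ?thesis using le_one_B[of a c] F_B[OF 2] by (simp add: regs)
  next
    case 3 then show ?thesis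
      using le_one_C[of a c] F_C[OF 3] reg_C_le_half[of a c] reg_C_le_half[of c a]
      by (simp add: regs)
  next
    case 4 then show ?thesis
      using le_one_Oct_swap[OF le_one_B[of c a]] F_D[OF 4] by (simp add: regs)
  next
    case 5 then show ?thesis
      using le_one_Oct_swap[OF le_one_A[of c a]] F_E[OF 5] by (simp add: regs)
  qed
  then show "le_one_Oct a b c" if "b \<le> F (a, c)"
    using le_one_Oct_mono that by blast
qed

section \<open>Attainment of the norm and description of the unit ball\<close>

lemma compact_Oct: "compact Oct"
proof -
  have "Oct = ({0..1} \<times> {0..1}) \<inter> {p. fst p + snd p \<le> sqrt 2}"
    by (auto simp: Oct_def)
  moreover have "compact \<dots>"
    by (auto intro!: compact_Int_closed compact_Times closed_Collect_le continuous_intros)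
  ultimately show ?thesis by simp
qed

lemma norm_Oct_attained:
  obtains p where "p \<in> Oct" "norm_Oct P = \<bar>qform P p\<bar>"
    "\<And>q. q \<in> Oct \<Longrightarrow> \<bar>qform P q\<bar> \<le> norm_Oct P"
proof -
  obtain a b c where P: "P = (a, b, c)" by (cases P)
  have q: "qform P = (\<lambda>p. a * (fst p)\<^sup>2 + b * fst p * snd p + c * (snd p)\<^sup>2)"
    by (auto simp: P)
  have "continuous_on Oct (\<lambda>p. \<bar>qform P p\<bar>)" unfolding q by (intro continuous_intros)
  moreover have "Oct \<noteq> {}" using Oct_edge[of 0] tau_pos by auto
  ultimately obtain p where p: "p \<in> Oct" "\<forall>q\<in>Oct. \<bar>qform P q\<bar> \<le> \<bar>qform P p\<bar>"
    using continuous_attains_sup[OF compact_Oct] by blast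
  have "norm_Oct P = \<bar>qform P p\<bar>"
    unfolding norm_Oct_def using p by (intro cSup_eq_maximum) auto
  then show ?thesis using that p by simp
qed

lemma qform_uminus: "qform (- a, - b, - c) p = - qform (a, b, c) p"
  by (cases p) simp

lemma norm_Oct_uminus: "norm_Oct (- a, - b, - c) = norm_Oct (a, b, c)"
  by (simp add: norm_Oct_def qform_uminus)

lemma Sq_uminus: "(- a, - c) \<in> Sq \<longleftrightarrow> (a, c) \<in> Sq"
  by (auto simp: Sq_def)

lemma ball_iff:
  "norm_Oct (a, b, c) \<le> 1 \<longleftrightarrow> (a, c) \<in> Sq \<and> G (a, c) \<le> b \<and> b \<le> F (a, c)"
proof -
  obtain p where p: "p \<in> Oct" "norm_Oct (a, b, c) = \<bar>qform (a, b, c) p\<bar>"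
    "\<And>q. q \<in> Oct \<Longrightarrow> \<bar>qform (a, b, c) q\<bar> \<le> norm_Oct (a, b, c)"
    using norm_Oct_attained[of "(a, b, c)"] by blast
  have "norm_Oct (a, b, c) \<le> 1 \<longleftrightarrow> (\<forall>q\<in>Oct. \<bar>qform (a, b, c) q\<bar> \<le> 1)"
    using p by (metis order_trans)
  also have "\<dots> \<longleftrightarrow> le_one_Oct a b c \<and> le_one_Oct (- a) (- b) (- c)"
    unfolding le_one_Oct_def qform_uminus by (auto simp: abs_le_iff)
  finally have 1: "norm_Oct (a, b, c) \<le> 1 \<longleftrightarrow> le_one_Oct a b c \<and> le_one_Oct (- a) (- b) (- c)" .
  \<comment> \<open>At these two points the form takes the values \<open>a\<close> and
    \<open>c\<close>, which forces \<open>(a, c)\<close> into the square.\<close>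
  have "(1, 0) \<in> Oct" "(0, 1) \<in> Oct" by (auto simp: Oct_def)
  then have "(a, c) \<in> Sq" if "le_one_Oct a b c" "le_one_Oct (- a) (- b) (- c)"
    using that[THEN le_one_OctD, of 1 0] that[THEN le_one_OctD, of 0 1] by (simp add: Sq_def)
  then show ?thesis
    unfolding 1 using le_one_Oct_iff[of a c b] le_one_Oct_iff[of "- a" "- c" "- b"] Sq_uminus[of a c]
    by (auto simp: G_def)
qed

section \<open>Lower bounds on \<open>F\<close> and the order of the two graphs\<close>

lemma F_lower:
  assumes "(a, c) \<in> Sq"
  shows "- \<tau> \<le> F (a, c)" "F (a, c) < 0 \<Longrightarrow> 0 < a \<and> 0 < c"
proof -
  note regs = reg_A_def reg_B_def reg_C_def reg_D_def reg_E_def Sq_def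
  consider "(a, c) \<in> reg_A" | "(a, c) \<in> reg_B" | "(a, c) \<in> reg_C" | "(a, c) \<in> reg_D"
    | "(a, c) \<in> reg_E"
    using assms Sq_cover by blast
  then have "- \<tau> \<le> F (a, c) \<and> (F (a, c) < 0 \<longrightarrow> 0 < a \<and> 0 < c)"
  proof cases
    case 1
    then have "0 \<le> F (a, c)" unfolding F_A[OF 1] by (simp add: regs mult_nonpos_nonneg)
    then show ?thesis using tau_pos by simp
  next
    case 2
    then have "0 \<le> (1 - c) / \<tau>" "\<tau> * a \<le> \<tau> * 1" "0 < a \<longrightarrow> 0 < c"
      "a \<le> 0 \<longrightarrow> \<tau> * a \<le> 0"
      using tau_pos by (auto simp: regs mult_le_0_iff)
    then show ?thesis unfolding F_B[OF 2] by auto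
  next
    case 3
    then have "0 \<le> (1 - 2 * a) * (1 - 2 * c)"
      using reg_C_le_half[of a c] reg_C_le_half[of c a] by (simp add: regs)
    then have "1 \<le> F (a, c)" unfolding F_C[OF 3] by simp
    then show ?thesis using tau_pos by simp
  next
    case 4
    then have "0 \<le> (1 - a) / \<tau>" "\<tau> * c \<le> \<tau> * 1" "0 < c \<longrightarrow> 0 < a"
      "c \<le> 0 \<longrightarrow> \<tau> * c \<le> 0"
      using tau_pos by (auto simp: regs mult_le_0_iff)
    then show ?thesis unfolding F_D[OF 4] by auto
  next
    case 5
    then have "0 \<le> F (a, c)" unfolding F_E[OF 5] by (simp add: regs mult_nonpos_nonneg)
    then show ?thesis using tau_pos by simp
  qed
  then show "- \<tau> \<le> F (a, c)" "F (a, c) < 0 \<Longrightarrow> 0 < a \<and> 0 < c" by auto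
qed

text \<open>This quadrant of the square lies in region C, because
  \<open>\<tau>\<^sup>2 \<le> \<tau>\<close> keeps both right-hand sides of the region inequalities
  nonnegative.\<close>

lemma F_nonpos_ge_one:
  assumes "(a, c) \<in> Sq" "a \<le> 0" "c \<le> 0"
  shows "1 \<le> F (a, c)"
proof -
  have "(a, c) \<in> reg_C"
    using assms Sq_bounds[OF assms(1)] tau_sq_less tau_sq unfolding reg_C_def by simp
  then show ?thesis using F_C assms by (simp add: mult_nonneg_nonneg)
qed

text \<open>Where \<open>F\<close> is negative both coordinates are positive, so at the opposite
  point \<open>F\<close> is at least 1, which outweighs the loss of at most \<open>\<tau>\<close>.
  The order is what puts both graphs inside the unit ball.\<close>

lemma G_le_F:
  assumes "(a, c) \<in> Sq"
  shows "G (a, c) \<le> F (a, c)"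
proof -
  have m: "(- a, - c) \<in> Sq" using assms Sq_uminus by blast
  have "0 \<le> F (a, c) + F (- a, - c)"
    using F_lower[OF assms] F_lower[OF m] F_nonpos_ge_one[OF assms] F_nonpos_ge_one[OF m]
      tau_less_half by linarith
  then show ?thesis by (simp add: G_def)
qed

section \<open>The three pieces lie on the sphere\<close>

lemma graph_F_subset: "graph F \<subseteq> sphere_Oct"
proof
  fix P assume "P \<in> graph F"
  then obtain a c where P: "P = (a, F (a, c), c)" and ac: "(a, c) \<in> Sq" by (auto simp: graph_def)
  let ?b = "F (a, c)" and ?m = "norm_Oct (a, F (a, c), c)"
  have le: "?m \<le> 1" using ball_iff ac G_le_F by simp
  moreover have "\<not> ?m < 1"
  proof
    assume m: "?m < 1"
    \<comment> \<open>As \<open>x * y \<le> 1\<close>, raising \<open>b\<close> by the slack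
      \<open>1 - ?m\<close> raises \<open>P\<close> by at most that slack. This contradicts that
      \<open>F (a, c)\<close> is the largest admissible \<open>b\<close>.\<close>
    have "le_one_Oct a (?b + (1 - ?m)) c"
    proof (rule le_one_OctI)
      fix x y assume p: "(x, y) \<in> Oct"
      have "\<bar>qform (a, ?b, c) (x, y)\<bar> \<le> ?m" using norm_Oct_attained[of "(a, ?b, c)"] p by blast
      moreover have "x * y \<le> 1 * 1" using OctD[OF p] by (intro mult_mono) auto
      then have "(1 - ?m) * (x * y) \<le> (1 - ?m) * 1" using m by (intro mult_left_mono) auto
      ultimately show "a * x\<^sup>2 + (?b + (1 - ?m)) * x * y + c * y\<^sup>2 \<le> 1"
        by (simp add: algebra_simps abs_le_iff)
    qed
    then show False using le_one_Oct_iff[OF ac] m by simp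
  qed
  ultimately show "P \<in> sphere_Oct" by (simp add: P sphere_Oct_def)
qed

lemma sphere_Oct_uminus: "(- a, - b, - c) \<in> sphere_Oct \<longleftrightarrow> (a, b, c) \<in> sphere_Oct"
  by (simp add: sphere_Oct_def norm_Oct_uminus)

lemma graph_G_subset: "graph G \<subseteq> sphere_Oct"
proof
  fix P assume "P \<in> graph G"
  then obtain a c where P: "P = (a, G (a, c), c)" and ac: "(a, c) \<in> Sq" by (auto simp: graph_def)
  have "(- a, F (- a, - c), - c) \<in> graph F" using ac Sq_uminus by (auto simp: graph_def)
  then have "(- a, - G (a, c), - c) \<in> sphere_Oct" using graph_F_subset by (auto simp: G_def)
  then show "P \<in> sphere_Oct" unfolding P sphere_Oct_uminus .
qed

lemma frontier_Sq: "(a, c) \<in> frontier Sq \<longleftrightarrow> (a, c) \<in> Sq \<and> (\<bar>a\<bar> = 1 \<or> \<bar>c\<bar> = 1)"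
proof -
  have "frontier Sq = Sq - {-1<..<1} \<times> {-1<..<1}"
    by (simp add: frontier_def Sq_def closure_Times interior_Times)
  then show ?thesis by (auto simp: Sq_def)
qed

lemma \<V>_subset: "\<V> \<subseteq> sphere_Oct"
proof
  fix P assume "P \<in> \<V>"
  then obtain a b c where P: "P = (a, b, c)" "(a, c) \<in> Sq" "\<bar>a\<bar> = 1 \<or> \<bar>c\<bar> = 1"
    "G (a, c) \<le> b" "b \<le> F (a, c)"
    by (auto simp: \<V>_def frontier_Sq)
  \<comment> \<open>These points give the values \<open>a\<close> and \<open>c\<close>, one of
    modulus 1, hence norm at least 1; \<open>ball_iff\<close> supplies the converse bound.\<close>
  have "(1, 0) \<in> Oct" "(0, 1) \<in> Oct" by (auto simp: Oct_def)
  then have "\<bar>qform P (1, 0)\<bar> \<le> norm_Oct P" "\<bar>qform P (0, 1)\<bar> \<le> norm_Oct P"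
    using norm_Oct_attained[of P] by blast+
  then show "P \<in> sphere_Oct" using P ball_iff[of a b c] by (auto simp: sphere_Oct_def)
qed

section \<open>Points of the sphere over the open square\<close>

lemma extremal_point:
  assumes ac: "(a, c) \<in> Sq" "\<bar>a\<bar> < 1" "\<bar>c\<bar> < 1" and b: "b \<le> F (a, c)"
    and p: "p \<in> Oct" "qform (a, b, c) p = 1"
  shows "b = F (a, c)"
proof -
  obtain x y where xy: "p = (x, y)" by (cases p)
  note o = OctD[OF p(1)[unfolded xy]]
  \<comment> \<open>On the axes \<open>P\<close> reduces to \<open>a * x\<^sup>2\<close> or
    \<open>c * y\<^sup>2\<close>, which stays below 1 for \<open>\<bar>a\<bar> < 1\<close> and
    \<open>\<bar>c\<bar> < 1\<close>.\<close>
  have "x * y \<noteq> 0"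
  proof
    have sq: "x\<^sup>2 \<le> 1" "y\<^sup>2 \<le> 1" using o by (simp_all add: power_le_one)
    have *: "r * z < 1" if "\<bar>r\<bar> < 1" "0 \<le> z" "z \<le> 1" for r z :: real
    proof -
      have "r * z \<le> \<bar>r\<bar> * 1" using that by (intro mult_mono) auto
      then show ?thesis using that by simp
    qed
    assume "x * y = 0"
    then show False using p *[OF ac(2) _ sq(1)] *[OF ac(3) _ sq(2)] by (auto simp: xy)
  qed
  then have pos: "0 < x * y" using o by (metis less_eq_real_def mult_nonneg_nonneg)
  have "le_one_Oct a (F (a, c)) c" using le_one_Oct_iff[OF ac(1)] by simp
  from le_one_OctD[OF this p(1)[unfolded xy]] have "F (a, c) * (x * y) \<le> b * (x * y)"
    using p by (simp add: xy algebra_simps)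
  then have "F (a, c) \<le> b" using pos by (rule mult_right_le_imp_le)
  then show ?thesis using b by simp
qed

theorem theorem3p3:
  shows "sphere_Oct = graph F \<union> graph G \<union> \<V>"
proof
  show "graph F \<union> graph G \<union> \<V> \<subseteq> sphere_Oct"
    using graph_F_subset graph_G_subset \<V>_subset by blast
  show "sphere_Oct \<subseteq> graph F \<union> graph G \<union> \<V>"
  proof
    fix P assume P: "P \<in> sphere_Oct"
    obtain a b c where abc: "P = (a, b, c)" by (cases P)
    have n: "norm_Oct (a, b, c) = 1" using P by (simp add: abc sphere_Oct_def)
    then have ball: "(a, c) \<in> Sq" "G (a, c) \<le> b" "b \<le> F (a, c)" using ball_iff[of a b c] by auto
    show "P \<in> graph F \<union> graph G \<union> \<V>"
    proof (cases "\<bar>a\<bar> = 1 \<or> \<bar>c\<bar> = 1")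
      case True
      then show ?thesis using ball by (simp add: abc \<V>_def frontier_Sq)
    next
      case False
      then have lt: "\<bar>a\<bar> < 1" "\<bar>c\<bar> < 1" using ball(1) by (auto simp: Sq_def)
      obtain p where p: "p \<in> Oct" "\<bar>qform (a, b, c) p\<bar> = 1"
        using norm_Oct_attained[of "(a, b, c)"] n by metis
      \<comment> \<open>The value -1 is the value 1 of the negated form, so
        \<open>extremal_point\<close> at \<open>(- a, - c)\<close> yields the graph of
        \<open>G\<close>.\<close>
      then consider "qform (a, b, c) p = 1" | "qform (- a, - b, - c) p = 1"
        unfolding qform_uminus by linarith
      then show ?thesis
      proof cases
        case 1
        then have "b = F (a, c)" using extremal_point ball lt p by blast
        then show ?thesis using ball by (auto simp: abc graph_def)
      next
        case 2
        then have "- b = F (- a, - c)"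
          using extremal_point[of "- a" "- c" "- b" p] ball lt p Sq_uminus by (simp add: G_def)
        then have "b = G (a, c)" by (simp add: G_def)
        then show ?thesis using ball by (auto simp: abc graph_def)
      qed
    qed
  qed
qed

end
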